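(* Let $\mathbf{A} \in \mathbb{R}^{n\times d}$, $p\geq 2$, $0<\epsilon<1$, and let $w\in\mathbb{R}^n_{>0}$ be a one-sided $\epsilon$-approximate $\ell_p$-Lewis weight of $\mathbf{A}$. Let $v\in\mathbb{R}^n$ be given by $v_i = w_i^{1-\frac{p}{2}}\, \sigma_i(\mathbf{W}^{\frac12-\frac1p}\mathbf{A})^{\frac{p}{2}}$ for all $i\in[n]$. Then, for $\alpha = 3\epsilon (\frac{p}{2} - 1) (1 + \epsilon)^{\frac{p}{2}-1} d$, we have for all $i\in[n]$ \[ (1-\alpha)\,\sigma_{i}(\mathbf{V}^{\frac{1}{2}-\frac{1}{p}}\mathbf{A})\leq v_{i}\leq(1+\alpha)\,\sigma_{i}(\mathbf{V}^{\frac{1}{2}-\frac{1}{p}}\mathbf{A}). \]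
   Context: $\mathbf{W} = \mathrm{Diag}(w)$, $\mathbf{V} = \mathrm{Diag}(v)$. For a matrix $\mathbf{B} \in \mathbb{R}^{n\times d}$ with rows $b_i^\top$, the leverage scores are $\sigma(\mathbf{B}) \in \mathbb{R}^n$ with $\sigma_i(\mathbf{B}) = b_i^\top (\mathbf{B}^\top \mathbf{B})^+ b_i$ ($^+$ the pseudoinverse). $w$ is a one-sided $\epsilon$-approximate $\ell_p$-Lewis weight of $\mathbf{A}$ if $\sigma(\mathbf{W}^{\frac12-\frac1p}\mathbf{A}) \leq (1+\epsilon) w$ entrywise and $\|w\|_1 \leq (1+\epsilon)d$.
   Formalization: The formal theorem additionally assumes that A has full column rank d; without it the claim fails, e.g. A = [1 0] (n=1, d=2), p=4, ε=1/100, w=2 gives v=1/2, σ(V^{1/4}A)=1 and α=0.0606, so the lower bound is violated. *)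

theory Defs
  imports "HOL-Analysis.Analysis"
begin

definition is_pseudoinverse :: "real^'n^'m \<Rightarrow> real^'m^'n \<Rightarrow> bool" where
  "is_pseudoinverse A X \<longleftrightarrow>
     A ** X ** A = A \<and> X ** A ** X = X \<and>
     transpose (A ** X) = A ** X \<and> transpose (X ** A) = X ** A"

definition pseudoinverse :: "real^'n^'m \<Rightarrow> real^'m^'n" where
  "pseudoinverse A = (THE X. is_pseudoinverse A X)"

lemma is_pseudoinverse_unique:
  assumes X: "is_pseudoinverse A X" and Y: "is_pseudoinverse A Y"
  shows "X = Y"
proof -
  note x = X[unfolded is_pseudoinverse_def] and y = Y[unfolded is_pseudoinverse_def]
  have "A ** X = (A ** Y) ** (A ** X)"
    using y by (simp add: matrix_mul_assoc)
  also have "\<dots> = transpose ((A ** X) ** (A ** Y))"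
    using x y by (simp add: matrix_transpose_mul)
  also have "\<dots> = A ** Y"
    using x y by (simp add: matrix_mul_assoc)
  finally have AX: "A ** X = A ** Y" .
  have "X ** A = (X ** A) ** (Y ** A)"
    using y by (metis matrix_mul_assoc)
  also have "\<dots> = transpose ((Y ** A) ** (X ** A))"
    using x y by (simp add: matrix_transpose_mul)
  also have "\<dots> = Y ** A"
    using x y by (metis matrix_mul_assoc)
  finally have XA: "X ** A = Y ** A" .
  show "X = Y"
    using x y AX XA by (metis matrix_mul_assoc)
qed

lemma pseudoinverse_eqI: "is_pseudoinverse A X \<Longrightarrow> pseudoinverse A = X"
  unfolding pseudoinverse_def using is_pseudoinverse_unique by blast

definition leverage_score :: "real^'d^'n \<Rightarrow> 'n \<Rightarrow> real" where
  "leverage_score B i = row i B \<bullet> (pseudoinverse (transpose B ** B) *v row i B)"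

text \<open>
  \<open>diag_power w a\<close> is \<open>Diag(w)\<close> raised to the power \<open>a\<close>, for entrywise nonnegative \<open>w\<close>.
  The case distinction is there because \<open>0 powr 0 = 0\<close>, whereas the zeroth power of
  a diagonal matrix is the identity.
\<close>
definition diag_power :: "real^'n \<Rightarrow> real \<Rightarrow> real^'n^'n" where
  "diag_power w a = (\<chi> i j. if i = j then (if a = 0 then 1 else w $ i powr a) else 0)"

definition one_sided_lewis_weight :: "real \<Rightarrow> real \<Rightarrow> real^'d^'n \<Rightarrow> real^'n \<Rightarrow> bool" where
  "one_sided_lewis_weight \<epsilon> p A w \<longleftrightarrow>
     (\<forall>i. leverage_score (diag_power w (1/2 - 1/p) ** A) i \<le> (1 + \<epsilon>) * w $ i) \<and>
     (\<Sum>i\<in>UNIV. \<bar>w $ i\<bar>) \<le> (1 + \<epsilon>) * real CARD('d)"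

end

theory Submission
  imports Defs
begin

text \<open>
  Put \<open>B = W\<^bsup>1/2-1/p\<^esup>A\<close>, \<open>C = V\<^bsup>1/2-1/p\<^esup>A\<close>, \<open>r\<^sub>i = \<sigma>\<^sub>i(B) / w\<^sub>i\<close> and \<open>q = p/2 - 1\<close>.
  Then \<open>v\<^sub>i = r\<^sub>i\<^bsup>q\<^esup> \<sigma>\<^sub>i(B)\<close> and \<open>\<parallel>Cy\<parallel>\<^sup>2 = \<Sum>\<^sub>i r\<^sub>i\<^bsup>q\<^esup> (By)\<^sub>i\<^sup>2\<close>, so it suffices to compare the
  quadratic forms \<open>\<parallel>By\<parallel>\<^sup>2\<close> and \<open>\<parallel>Cy\<parallel>\<^sup>2\<close> and to pass to inverses.
  The upper bound is \<open>r\<^sub>i \<le> 1 + \<epsilon>\<close>. For the lower bound, \<open>(By)\<^sub>i\<^sup>2 \<le> \<sigma>\<^sub>i(B) \<parallel>By\<parallel>\<^sup>2\<close> and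
  \<open>r (1 - r\<^bsup>q\<^esup>) \<le> q (1 - r)\<close> for \<open>r \<le> 1\<close> bound the defect by \<open>q \<Sum>\<^sub>i ((1 + \<epsilon>) w\<^sub>i - \<sigma>\<^sub>i(B))\<close>, and
  \<open>\<Sum>\<^sub>i \<sigma>\<^sub>i(B) = d\<close> together with \<open>\<parallel>w\<parallel>\<^sub>1 \<le> (1 + \<epsilon>) d\<close> makes this at most \<open>3 \<epsilon> q d\<close>.
\<close>

section \<open>Quadratic forms of inverse Gram matrices\<close>

definition inverse_gram_form :: "real^'d^'n \<Rightarrow> real^'d \<Rightarrow> real" where
  "inverse_gram_form B u = u \<bullet> (pseudoinverse (transpose B ** B) *v u)"

lemma inner_gram: "((transpose B ** B) *v x) \<bullet> y = (B *v x) \<bullet> (B *v y)"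
  for B :: "real^'d^'n"
  by (metis dot_lmul_matrix inner_commute matrix_vector_mul_assoc transpose_matrix_vector)

text \<open>A kernel vector \<open>x\<close> of the Gram matrix has \<open>B *v x = 0\<close>, so
  injectivity gives an inverse; an inverse satisfies the Penrose equations and is therefore the
  pseudoinverse.\<close>

lemma pseudoinverse_gram:
  fixes B :: "real^'d^'n"
  assumes "inj ((*v) B)"
  shows "(transpose B ** B) ** pseudoinverse (transpose B ** B) = mat 1"
    and "pseudoinverse (transpose B ** B) ** (transpose B ** B) = mat 1"
proof -
  define G where "G = transpose B ** B"
  have "x = 0" if "G *v x = 0" for x
  proof -
    have "(B *v x) \<bullet> (B *v x) = 0"
      using inner_gram[of B x x] that by (simp add: G_def)
    then have "B *v x = B *v 0" by simp
    then show ?thesis using assms by (metis injD)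
  qed
  then obtain X where XG: "X ** G = mat 1"
    using matrix_left_invertible_ker[of G] by blast
  then have GX: "G ** X = mat 1" by (simp add: matrix_left_right_inverse)
  have "is_pseudoinverse G X"
    by (simp add: is_pseudoinverse_def XG GX transpose_mat)
  then have "pseudoinverse G = X" by (rule pseudoinverse_eqI)
  with XG GX show "(transpose B ** B) ** pseudoinverse (transpose B ** B) = mat 1"
    and "pseudoinverse (transpose B ** B) ** (transpose B ** B) = mat 1"
    by (auto simp: G_def)
qed

lemma gram_pseudoinverse_apply:
  fixes B :: "real^'d^'n"
  assumes "inj ((*v) B)"
  shows "(transpose B ** B) *v (pseudoinverse (transpose B ** B) *v u) = u"
  using pseudoinverse_gram(1)[OF assms] by (metis matrix_vector_mul_assoc matrix_vector_mul_lid)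

lemma inverse_gram_form_eq_norm:
  fixes B :: "real^'d^'n"
  assumes "inj ((*v) B)"
  shows "inverse_gram_form B u = (norm (B *v (pseudoinverse (transpose B ** B) *v u)))\<^sup>2"
  using inner_gram[of B "pseudoinverse (transpose B ** B) *v u" "pseudoinverse (transpose B ** B) *v u"]
  unfolding gram_pseudoinverse_apply[OF assms]
  by (simp add: inverse_gram_form_def power2_norm_eq_inner)

text \<open>Cauchy-Schwarz for \<open>B *v ?z\<close> and \<open>B *v y\<close>, where
  \<open>?z\<close> solves the normal equations with right-hand side \<open>u\<close>.\<close>

lemma inner_power2_le_inverse_gram_form:
  fixes B :: "real^'d^'n"
  assumes "inj ((*v) B)"
  shows "(u \<bullet> y)\<^sup>2 \<le> inverse_gram_form B u * (norm (B *v y))\<^sup>2"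
proof -
  let ?z = "pseudoinverse (transpose B ** B) *v u"
  have "u \<bullet> y = (B *v ?z) \<bullet> (B *v y)"
    using inner_gram[of B ?z y] unfolding gram_pseudoinverse_apply[OF assms] .
  then have "(u \<bullet> y)\<^sup>2 \<le> (norm (B *v ?z) * norm (B *v y))\<^sup>2"
    by (metis Cauchy_Schwarz_ineq2 abs_ge_zero power2_abs power_mono)
  then show ?thesis
    by (simp add: inverse_gram_form_eq_norm[OF assms] power_mult_distrib)
qed

text \<open>Inversion reverses the order of quadratic forms. Testing the Cauchy-Schwarz bound for
  \<open>B\<close> at the solution \<open>?z\<close> for \<open>C\<close> works because
  \<open>u \<bullet> ?z\<close> and the squared norm of \<open>C *v ?z\<close> are both the form of
  \<open>C\<close> at \<open>u\<close>; one factor of it then cancels.\<close>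

lemma inverse_gram_form_antimono:
  fixes B :: "real^'d^'n" and C :: "real^'d^'m"
  assumes B: "inj ((*v) B)" and C: "inj ((*v) C)"
    and le: "\<And>y. (norm (B *v y))\<^sup>2 \<le> c * (norm (C *v y))\<^sup>2"
  shows "inverse_gram_form C u \<le> c * inverse_gram_form B u"
proof -
  let ?z = "pseudoinverse (transpose C ** C) *v u"
  have nonneg: "0 \<le> inverse_gram_form B u" "0 \<le> inverse_gram_form C u"
    by (simp_all add: inverse_gram_form_eq_norm B C)
  have "(inverse_gram_form C u)\<^sup>2 \<le> inverse_gram_form B u * (norm (B *v ?z))\<^sup>2"
    using inner_power2_le_inverse_gram_form[OF B, of u ?z] by (simp add: inverse_gram_form_def)
  also have "\<dots> \<le> inverse_gram_form B u * (c * inverse_gram_form C u)"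
    using le[of ?z] nonneg by (simp add: inverse_gram_form_eq_norm[OF C] mult_left_mono)
  finally have *: "inverse_gram_form C u * inverse_gram_form C u
      \<le> c * inverse_gram_form B u * inverse_gram_form C u"
    by (simp add: power2_eq_square mult_ac)
  show ?thesis
  proof (cases "inverse_gram_form C u = 0")
    case True
    have "u = 0"
    proof -
      have "C *v ?z = C *v 0" using True by (simp add: inverse_gram_form_eq_norm[OF C])
      then have "?z = 0" using C by (metis injD)
      then show ?thesis using gram_pseudoinverse_apply[OF C, of u] by simp
    qed
    then show ?thesis by (simp add: inverse_gram_form_def)
  next
    case False
    with nonneg have "0 < inverse_gram_form C u" by simp
    with * show ?thesis by simp
  qed
qed

section \<open>Leverage scores and scaled rows\<close>

lemma leverage_score_eq_inverse_gram_form: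
  "leverage_score B i = inverse_gram_form B (row i B)"
  by (simp add: leverage_score_def inverse_gram_form_def)

text \<open>The sum is the trace of \<open>X ** (transpose B ** B)\<close>, which is the identity
  matrix.\<close>

lemma sum_leverage_score:
  fixes B :: "real^'d^'n"
  assumes "inj ((*v) B)"
  shows "(\<Sum>i\<in>UNIV. leverage_score B i) = CARD('d)"
proof -
  define X where "X = pseudoinverse (transpose B ** B)"
  have "(\<Sum>i\<in>UNIV. leverage_score B i)
      = (\<Sum>i\<in>UNIV. \<Sum>j\<in>UNIV. \<Sum>k\<in>UNIV. B $ i $ j * (X $ j $ k * B $ i $ k))"
    by (simp add: leverage_score_def X_def[symmetric] inner_vec_def row_def
        matrix_vector_mult_def sum_distrib_left)
  also have "\<dots> = (\<Sum>j\<in>UNIV. \<Sum>i\<in>UNIV. \<Sum>k\<in>UNIV. B $ i $ j * (X $ j $ k * B $ i $ k))"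
    by (rule sum.swap)
  also have "\<dots> = (\<Sum>j\<in>UNIV. \<Sum>k\<in>UNIV. \<Sum>i\<in>UNIV. B $ i $ j * (X $ j $ k * B $ i $ k))"
    by (rule sum.cong[OF refl], rule sum.swap)
  also have "\<dots> = (\<Sum>j\<in>UNIV. (X ** (transpose B ** B)) $ j $ j)"
    by (simp add: matrix_matrix_mult_def transpose_def sum_distrib_left mult_ac)
  also have "\<dots> = CARD('d)"
    by (simp add: X_def pseudoinverse_gram(2)[OF assms] mat_def)
  finally show ?thesis .
qed

lemma row_mult_vector: "(B *v y) $ i = row i B \<bullet> y"
  by (simp add: matrix_vector_mul_component row_def)

lemma row_diag_power_mult:
  "row i (diag_power w a ** A) = (if a = 0 then 1 else w $ i powr a) *\<^sub>R row i A"
proof -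
  define c where "c i = (if a = 0 then 1 else w $ i powr a)" for i
  have "(\<Sum>k\<in>UNIV. (if i = k then c i else 0) * A $ k $ j) = c i * A $ i $ j" for j
    by (subst sum.remove[of _ i]) (auto intro!: sum.neutral)
  then show ?thesis
    unfolding diag_power_def c_def[symmetric]
    by (simp add: vec_eq_iff row_def matrix_matrix_mult_def)
qed

lemma inverse_gram_form_scaleR: "inverse_gram_form B (c *\<^sub>R u) = c\<^sup>2 * inverse_gram_form B u"
  by (simp add: inverse_gram_form_def matrix_vector_mult_scaleR power2_eq_square)

section \<open>Scalar inequalities for real powers\<close>

lemma one_minus_powr_le:
  fixes r q :: real
  assumes "0 \<le> r" "r \<le> 1" "0 < q"
  shows "r * (1 - r powr q) \<le> q * (1 - r)"
proof (cases "r = 0")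
  case False
  with assms have r: "0 < r" by simp
  \<comment> \<open>Two tangent-line bounds, for exp here and for ln next, give a bound with
    \<open>1 / r\<close>; multiplying by \<open>r\<close> removes the pole.\<close>
  have "1 + q * ln r \<le> r powr q"
    using exp_ge_add_one_self[of "q * ln r"] r by (simp add: powr_def)
  moreover have "- ln r \<le> 1 / r - 1"
    using ln_le_minus_one[of "1 / r"] r by (simp add: ln_div)
  then have "q * (- ln r) \<le> q * (1 / r - 1)" using assms by (intro mult_left_mono) auto
  ultimately have "1 - r powr q \<le> q * (1 / r - 1)" by simp
  then have "r * (1 - r powr q) \<le> r * (q * (1 / r - 1))" using r by (intro mult_left_mono) auto
  also have "\<dots> = q * (1 - r)" using r by (simp add: field_simps)
  finally show ?thesis .
qed (use assms in simp)

text \<open>Rearranged from \<open>1 - q * \<epsilon> \<le> (1 + \<epsilon>) powr (- q)\<close>. The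
  power stays on the right because \<alpha> contains the same factor.\<close>

lemma powr_one_plus_le:
  fixes \<epsilon> q :: real
  assumes "0 \<le> \<epsilon>" "0 \<le> q"
  shows "(1 + \<epsilon>) powr q \<le> 1 + \<epsilon> * q * (1 + \<epsilon>) powr q"
proof -
  have "1 - q * \<epsilon> \<le> 1 - q * ln (1 + \<epsilon>)"
    using assms ln_add_one_self_le_self[of \<epsilon>] by (simp add: mult_left_mono)
  also have "\<dots> \<le> (1 + \<epsilon>) powr (- q)"
    using exp_ge_add_one_self[of "- q * ln (1 + \<epsilon>)"] assms by (simp add: powr_def)
  finally have "(1 - q * \<epsilon>) * (1 + \<epsilon>) powr q \<le> (1 + \<epsilon>) powr (- q) * (1 + \<epsilon>) powr q"
    by (rule mult_right_mono) simp
  also have "\<dots> = 1" using assms by (simp add: powr_add[symmetric])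
  finally show ?thesis by (simp add: algebra_simps)
qed

section \<open>Coordinates and injectivity under positive row scaling\<close>

lemma norm_power2_vec: "(norm x)\<^sup>2 = (\<Sum>i\<in>UNIV. (x $ i)\<^sup>2)" for x :: "real^'n"
  unfolding power2_norm_eq_inner by (simp add: inner_vec_def power2_eq_square)

lemma inj_diag_power_mult:
  fixes A :: "real^'d^'n"
  assumes "inj ((*v) A)" and "\<forall>i. w $ i > 0"
  shows "inj ((*v) (diag_power w a ** A))"
proof (rule injI)
  fix x y assume eq: "(diag_power w a ** A) *v x = (diag_power w a ** A) *v y"
  have "(A *v x) $ i = (A *v y) $ i" for i
    using arg_cong[OF eq, of "\<lambda>z. z $ i"] assms(2)[rule_format, of i]
    by (simp add: row_mult_vector row_diag_power_mult split: if_splits)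
  then have "A *v x = A *v y" by (simp add: vec_eq_iff)
  then show "x = y" using assms(1) by (simp add: injD)
qed

theorem theorem3p3:
  fixes A :: "real^'d^'n" and w v :: "real^'n" and p \<epsilon> \<alpha> :: real
  assumes "rank A = CARD('d)"
    and "p \<ge> 2" and "0 < \<epsilon>" and "\<epsilon> < 1"
    and "\<forall>i. w $ i > 0"
    and "one_sided_lewis_weight \<epsilon> p A w"
    and "\<forall>i. v $ i = w $ i powr (1 - p/2)
                    * leverage_score (diag_power w (1/2 - 1/p) ** A) i powr (p/2)"
    and "\<alpha> = 3 * \<epsilon> * (p/2 - 1) * (1 + \<epsilon>) powr (p/2 - 1) * real CARD('d)"
  shows "\<forall>i. (1 - \<alpha>) * leverage_score (diag_power v (1/2 - 1/p) ** A) i \<le> v $ i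
           \<and> v $ i \<le> (1 + \<alpha>) * leverage_score (diag_power v (1/2 - 1/p) ** A) i"
proof -
  define a where "a = 1/2 - 1/p"
  define q where "q = p/2 - 1"
  define B where "B = diag_power w a ** A"
  define C where "C = diag_power v a ** A"
  define \<sigma> where "\<sigma> = leverage_score B"
  define r where "r i = \<sigma> i / w $ i" for i
  have w: "w $ i > 0" for i using assms(5) by simp
  \<comment> \<open>Full column rank passes to \<open>B\<close>, which makes its Gram matrix
    invertible and its leverage scores sum to exactly \<open>CARD('d)\<close>.\<close>
  have injA: "inj ((*v) A)" using assms(1) by (simp add: full_rank_injective)
  have injB: "inj ((*v) B)" unfolding B_def by (rule inj_diag_power_mult[OF injA assms(5)])
  have \<sigma>0: "0 \<le> \<sigma> i" for i
    by (simp add: \<sigma>_def leverage_score_eq_inverse_gram_form inverse_gram_form_eq_norm injB)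
  have v: "v $ i = w $ i powr (1 - p/2) * \<sigma> i powr (p/2)" for i
    using assms(7) by (simp add: \<sigma>_def B_def a_def)
  have \<sigma>_le: "\<sigma> i \<le> (1 + \<epsilon>) * w $ i" for i
    using assms(6) by (simp add: one_sided_lewis_weight_def \<sigma>_def B_def a_def)
  have sum_w: "(\<Sum>i\<in>UNIV. w $ i) \<le> (1 + \<epsilon>) * CARD('d)"
    using assms(6) w by (simp add: one_sided_lewis_weight_def abs_of_pos)
  have sum_\<sigma>: "(\<Sum>i\<in>UNIV. \<sigma> i) = CARD('d)"
    unfolding \<sigma>_def by (rule sum_leverage_score[OF injB])
  have "(1 - \<alpha>) * leverage_score C i \<le> v $ i \<and> v $ i \<le> (1 + \<alpha>) * leverage_score C i" for i
  \<comment> \<open>At \<open>p = 2\<close> the exponent \<open>a\<close> is 0, so both scalings are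
    the identity and the claim is an equality. Otherwise \<open>a > 0\<close>, and the
    \<open>powr\<close> branch of \<open>diag_power\<close> applies even where
    \<open>v $ i = 0\<close>.\<close>
  proof (cases "p = 2")
    case True
    then have "a = 0" by (simp add: a_def)
    then have "C = B" by (simp add: C_def B_def diag_power_def cong: if_cong)
    moreover have "\<alpha> = 0" "v $ i = \<sigma> i"
      using True w[of i] \<sigma>0[of i] by (simp_all add: assms(8) v)
    ultimately show ?thesis by (simp add: \<sigma>_def)
  next
    case False
    with assms(2) have p: "p > 2" by simp
    then have a: "a > 0" and q: "q > 0" by (simp_all add: a_def q_def field_simps)
    have r0: "0 \<le> r i" for i using \<sigma>0[of i] w[of i] by (simp add: r_def)
    have r_le: "r i \<le> 1 + \<epsilon>" for i
      using \<sigma>_le[of i] w[of i] by (simp add: r_def divide_le_eq)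
    have \<sigma>_eq: "\<sigma> i = r i * w $ i" for i using w[of i] by (simp add: r_def)
    have v_eq: "v $ i = w $ i * r i powr (p/2)" for i
    proof -
      have "w $ i powr (1 - p/2) * w $ i powr (p/2) = w $ i"
        using w[of i] by (simp add: powr_add[symmetric])
      then show ?thesis using w[of i] r0[of i] by (simp add: v \<sigma>_eq powr_mult mult_ac)
    qed
    have v_eq': "v $ i = r i powr q * \<sigma> i" for i
    proof (cases "r i = 0")
      case False
      have "r i powr (p/2) = r i powr (q + 1)" by (simp add: q_def)
      also have "\<dots> = r i powr q * r i" using r0[of i] False by (simp add: powr_add)
      finally show ?thesis by (simp add: v_eq \<sigma>_eq)
    qed (simp add: v_eq \<sigma>_eq)
    \<comment> \<open>Since \<open>p * a = q\<close>, passing from \<open>w\<close> to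
      \<open>v\<close> multiplies row \<open>i\<close> of \<open>B\<close> by
      \<open>r i powr (q/2)\<close>.\<close>
    have scale: "(v $ i powr a)\<^sup>2 = r i powr q * (w $ i powr a)\<^sup>2" for i
    proof -
      have "p/2 * a * 2 = q" using p by (simp add: a_def q_def field_simps)
      moreover have "v $ i powr a = w $ i powr a * r i powr (p/2 * a)"
        using w[of i] r0[of i] by (simp add: v_eq powr_mult powr_powr)
      moreover have "(r i powr (q/2))\<^sup>2 = r i powr q"
        by (simp add: power2_eq_square flip: powr_add)
      ultimately show ?thesis by (simp add: power_mult_distrib)
    qed
    have rowB: "row i B = w $ i powr a *\<^sub>R row i A" for i
      using a by (simp add: B_def row_diag_power_mult)
    have rowC: "row i C = v $ i powr a *\<^sub>R row i A" for i
      using a by (simp add: C_def row_diag_power_mult)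
    have normC: "(norm (C *v y))\<^sup>2 = (\<Sum>i\<in>UNIV. r i powr q * ((B *v y) $ i)\<^sup>2)" for y
      by (simp add: norm_power2_vec row_mult_vector rowB rowC power_mult_distrib scale mult_ac)
    have comp_le: "((B *v y) $ i)\<^sup>2 \<le> \<sigma> i * (norm (B *v y))\<^sup>2" for y i
      using inner_power2_le_inverse_gram_form[OF injB, of "row i B" y]
      by (simp add: \<sigma>_def leverage_score_eq_inverse_gram_form row_mult_vector)
    \<comment> \<open>Some \<open>r i\<close> may vanish and give \<open>C\<close> a zero row. Then
      \<open>\<sigma> i = 0\<close>, and \<open>comp_le\<close> forces coordinate \<open>i\<close>
      of \<open>B *v y\<close> to vanish as well, so no kernel is created.\<close>
    have injC: "inj ((*v) C)"
    proof -
      have "y = 0" if "C *v y = 0" for y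
      proof -
        have "(\<Sum>i\<in>UNIV. r i powr q * ((B *v y) $ i)\<^sup>2) = 0" using normC[of y] that by simp
        then have z: "r i powr q * ((B *v y) $ i)\<^sup>2 = 0" for i
          by (subst (asm) sum_nonneg_eq_0_iff) auto
        have "(B *v y) $ i = 0" for i
          using z[of i] comp_le[of y i] by (auto simp: \<sigma>_eq)
        then have "B *v y = B *v 0" by (simp add: vec_eq_iff)
        then show ?thesis using injB by (metis injD)
      qed
      then show ?thesis by (metis matrix_left_invertible_injective matrix_left_invertible_ker)
    qed
    define d where "d = real CARD('d)"
    have d: "1 \<le> d" by (simp add: d_def Suc_leI)
    have pow1: "1 \<le> (1 + \<epsilon>) powr q" using assms(3) q by (simp add: ge_one_powr_ge_zero)
    have \<alpha>: "\<alpha> = 3 * \<epsilon> * q * (1 + \<epsilon>) powr q * d" by (simp add: assms(8) q_def d_def)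
    have upper: "(norm (C *v y))\<^sup>2 \<le> (1 + \<alpha>) * (norm (B *v y))\<^sup>2" for y
    proof -
      \<comment> \<open>The constant \<alpha> exceeds what is needed here by the factor
        \<open>3 * d\<close>, which is at least 1.\<close>
      have "\<epsilon> * q * (1 + \<epsilon>) powr q * 1 \<le> \<epsilon> * q * (1 + \<epsilon>) powr q * (3 * d)"
        using assms(3) q d by (intro mult_left_mono) auto
      also have "\<dots> = \<alpha>" by (simp add: \<alpha>)
      finally have bd: "(1 + \<epsilon>) powr q \<le> 1 + \<alpha>"
        using powr_one_plus_le[of \<epsilon> q] assms(3) q by linarith
      have "r i powr q \<le> 1 + \<alpha>" for i
        using powr_mono2[OF _ r0 r_le, of q i] q bd by simp
      then have "(norm (C *v y))\<^sup>2 \<le> (\<Sum>i\<in>UNIV. (1 + \<alpha>) * ((B *v y) $ i)\<^sup>2)"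
        unfolding normC by (intro sum_mono mult_right_mono) auto
      then show ?thesis by (simp add: norm_power2_vec[of "B *v y"] sum_distrib_left)
    qed
    have lower: "(1 - \<alpha>) * (norm (B *v y))\<^sup>2 \<le> (norm (C *v y))\<^sup>2" for y
    proof -
      let ?N = "(norm (B *v y))\<^sup>2"
      \<comment> \<open>The slack \<open>(1 + \<epsilon>) * w $ i - \<sigma> i\<close>, unlike
        \<open>w $ i - \<sigma> i\<close>, is nonnegative for every \<open>i\<close>. Hence indices
        with \<open>r i > 1\<close>, whose left side is at most 0, obey the same bound and the sum
        can run over all indices.\<close>
      have summand_le: "(1 - r i powr q) * ((B *v y) $ i)\<^sup>2 \<le> q * ((1 + \<epsilon>) * w $ i - \<sigma> i) * ?N" for i
      proof (cases "r i \<le> 1")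
        case True
        have "r i powr q \<le> 1" using r0[of i] True q by (simp add: powr_le1)
        then have "(1 - r i powr q) * ((B *v y) $ i)\<^sup>2 \<le> (1 - r i powr q) * (\<sigma> i * ?N)"
          using comp_le[of y i] by (intro mult_left_mono) auto
        also have "\<dots> = r i * (1 - r i powr q) * (w $ i * ?N)" by (simp add: \<sigma>_eq)
        also have "\<dots> \<le> q * (1 - r i) * (w $ i * ?N)"
          using one_minus_powr_le[OF r0 True q] w[of i] by (intro mult_right_mono) auto
        also have "\<dots> = q * (w $ i - \<sigma> i) * ?N" by (simp add: \<sigma>_eq algebra_simps)
        also have "\<dots> \<le> q * ((1 + \<epsilon>) * w $ i - \<sigma> i) * ?N"
          using w[of i] q assms(3) by (intro mult_right_mono mult_left_mono) (auto simp: algebra_simps)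
        finally show ?thesis .
      next
        case False
        then have "1 \<le> r i powr q" using q by (simp add: ge_one_powr_ge_zero)
        then have "(1 - r i powr q) * ((B *v y) $ i)\<^sup>2 \<le> 0"
          by (simp add: mult_nonpos_nonneg)
        also have "0 \<le> q * ((1 + \<epsilon>) * w $ i - \<sigma> i) * ?N"
          using \<sigma>_le[of i] q by (intro mult_nonneg_nonneg) auto
        finally show ?thesis .
      qed
      have "?N - (norm (C *v y))\<^sup>2 = (\<Sum>i\<in>UNIV. (1 - r i powr q) * ((B *v y) $ i)\<^sup>2)"
        unfolding normC norm_power2_vec[of "B *v y"] by (simp add: left_diff_distrib sum_subtractf)
      also have "\<dots> \<le> (\<Sum>i\<in>UNIV. q * ((1 + \<epsilon>) * w $ i - \<sigma> i) * ?N)"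
        by (intro sum_mono summand_le)
      also have "\<dots> = q * ((1 + \<epsilon>) * (\<Sum>i\<in>UNIV. w $ i) - d) * ?N"
        unfolding d_def sum_\<sigma>[symmetric] sum_distrib_left sum_subtractf[symmetric] sum_distrib_right
        by simp
      also have "\<dots> \<le> q * (3 * \<epsilon> * d) * ?N"
      proof -
        \<comment> \<open>Origin of the 3: \<open>(1 + \<epsilon>) * (1 + \<epsilon>) - 1 = 2 *
          \<epsilon> + \<epsilon> * \<epsilon>\<close>, and \<open>\<epsilon> < 1\<close> bounds
          this by \<open>3 * \<epsilon>\<close>.\<close>
        have "(1 + \<epsilon>) * (\<Sum>i\<in>UNIV. w $ i) \<le> (1 + \<epsilon>) * ((1 + \<epsilon>) * d)"
          using sum_w assms(3) by (intro mult_left_mono) (auto simp: d_def)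
        moreover have "\<epsilon> * \<epsilon> * d \<le> \<epsilon> * 1 * d"
          using assms(3,4) d by (intro mult_right_mono mult_left_mono) auto
        ultimately have "(1 + \<epsilon>) * (\<Sum>i\<in>UNIV. w $ i) - d \<le> 3 * \<epsilon> * d"
          by (simp add: algebra_simps)
        then show ?thesis using q by (intro mult_right_mono mult_left_mono) auto
      qed
      also have "\<dots> \<le> \<alpha> * ?N"
      proof -
        have "3 * \<epsilon> * q * d * 1 \<le> 3 * \<epsilon> * q * d * (1 + \<epsilon>) powr q"
          using pow1 q d assms(3) by (intro mult_left_mono) auto
        also have "\<dots> = \<alpha>" by (simp add: \<alpha>)
        finally have "q * (3 * \<epsilon> * d) \<le> \<alpha>" by (simp add: mult_ac)
        then show ?thesis by (rule mult_right_mono) simp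
      qed
      finally show ?thesis by (simp add: algebra_simps)
    qed
    \<comment> \<open>Rows \<open>i\<close> of \<open>B\<close> and \<open>C\<close> are multiples
      of \<open>row i A\<close>. By \<open>v_eq'\<close> and \<open>scale\<close>, both
      \<open>v $ i\<close> and the leverage score of \<open>C\<close> are \<open>?s\<close> times an
      inverse Gram form at that row, so only the two forms need comparing.\<close>
    let ?s = "(v $ i powr a)\<^sup>2"
    have levC: "leverage_score C i = ?s * inverse_gram_form C (row i A)"
      by (simp add: leverage_score_eq_inverse_gram_form rowC inverse_gram_form_scaleR)
    have vi: "v $ i = ?s * inverse_gram_form B (row i A)"
      by (subst v_eq') (simp add: \<sigma>_def leverage_score_eq_inverse_gram_form rowB
          inverse_gram_form_scaleR scale)
    have nonneg: "0 \<le> leverage_score C i" "0 \<le> v $ i"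
      by (simp add: leverage_score_eq_inverse_gram_form inverse_gram_form_eq_norm injC)
        (simp add: v_eq' \<sigma>0)
    have "v $ i \<le> (1 + \<alpha>) * leverage_score C i"
      using mult_left_mono[OF inverse_gram_form_antimono[OF injC injB upper, of "row i A"], of ?s]
      by (simp add: levC flip: vi) (simp add: mult_ac)
    moreover have "(1 - \<alpha>) * leverage_score C i \<le> v $ i"
    \<comment> \<open>Inverting the lower comparison divides by \<open>1 - \<alpha>\<close>. If
      \<open>\<alpha> \<ge> 1\<close>, the left side is at most 0 while \<open>v $ i\<close> is
      nonnegative.\<close>
    proof (cases "\<alpha> < 1")
      case True
      then have "(norm (B *v y))\<^sup>2 \<le> 1 / (1 - \<alpha>) * (norm (C *v y))\<^sup>2" for y
        using lower[of y] by (simp add: field_simps)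
      from inverse_gram_form_antimono[OF injB injC this, of "row i A"] True
      have "(1 - \<alpha>) * inverse_gram_form C (row i A) \<le> inverse_gram_form B (row i A)"
        by (simp add: field_simps)
      from mult_left_mono[OF this, of ?s] show ?thesis
        by (simp add: levC flip: vi) (simp add: mult_ac)
    next
      case False
      then have "(1 - \<alpha>) * leverage_score C i \<le> 0"
        using nonneg by (simp add: mult_nonpos_nonneg)
      with nonneg show ?thesis by linarith
    qed
    ultimately show ?thesis by simp
  qed
  then show ?thesis by (simp add: C_def a_def)
qed

end
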